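(* Let $n\geqslant 2$, let $K\subset\mathbb{R}^n$ be a nonempty closed convex set whose recession cone $V$ is pointed, and let $P\subset\mathbb{R}^n$ be a (nonempty) polytope. Then $P$ is a summand of $K$ if and only if for every $u\in S^{n-1}$ such that $P(u)$ is an edge of $P$ and $K(u)$ is nonempty and bounded, the set $K(u)$ contains a translate of $P(u)$.
   Context: The recession cone of a nonempty closed convex set $K$ is $\{x\in\mathbb{R}^n\mid x+K\subset K\}$; a cone $V$ is pointed if $V\cap(-V)=\{0\}$. A polytope is the convex hull of a finite set of points. For a closed convex set $A\subset\mathbb{R}^n$ and $u\in\mathbb{R}^n$, the support set is $A(u)=\{a\in A\mid \langle a,u\rangle=\max_{x\in A}\langle x,u\rangle\}$ (empty if the maximum is not attained). An edge is a one-dimensional bounded support set, i.e. a nondegenerate line segment. $P$ is a summand of $K$ if $K=P+A$ (Minkowski sum) for some nonempty closed convex set $A\subset\mathbb{R}^n$. $S^{n-1}$ is the Euclidean unit sphere. *)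

theory Defs
  imports "HOL-Analysis.Analysis"
begin

definition recession_cone :: "'a::euclidean_space set \<Rightarrow> 'a set" where
  "recession_cone K = {x. (+) x ` K \<subseteq> K}"

(* The unary minus on sets is the complement, so the reflection -V is written as an image. *)
definition pointed :: "'a::euclidean_space set \<Rightarrow> bool" where
  "pointed V \<longleftrightarrow> V \<inter> uminus ` V = {0}"

(* The points of A where the linear functional given by u attains its maximum over A;
   empty if the maximum is not attained. *)
definition support_set :: "'a::euclidean_space set \<Rightarrow> 'a \<Rightarrow> 'a set" where
  "support_set A u = {a \<in> A. \<forall>x\<in>A. x \<bullet> u \<le> a \<bullet> u}"

(* In contrast to edge_of, this asks for a support set instead of a face,
   and unbounded one-dimensional support sets (rays and lines) are excluded. *)
definition bounded_edge_of :: "'a::euclidean_space set \<Rightarrow> 'a set \<Rightarrow> bool" where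
  "bounded_edge_of E A \<longleftrightarrow> (\<exists>u. E = support_set A u) \<and> aff_dim E = 1 \<and> bounded E"

definition summand_of :: "'a::euclidean_space set \<Rightarrow> 'a set \<Rightarrow> bool" where
  "summand_of P K \<longleftrightarrow> (\<exists>A. A \<noteq> {} \<and> closed A \<and> convex A \<and> K = P + A)"

definition contains_translate_of :: "'a::euclidean_space set \<Rightarrow> 'a set \<Rightarrow> bool" where
  "contains_translate_of B C \<longleftrightarrow> (\<exists>t. (+) t ` C \<subseteq> B)"

end

theory Submission
  imports Defs
begin

text \<open>
One direction is immediate: a functional that is maximal over \<open>P + A\<close> at \<open>p + a\<close> is maximal over
\<open>P\<close> at \<open>p\<close>, and then \<open>a + P(u)\<close> lies in the support set of the sum.

For the converse let \<open>P\<close> be the hull of the finite set \<open>F\<close> and let \<open>A\<close> be the set of all \<open>x\<close> with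
\<open>P + x \<subseteq> K\<close>, which is the largest set with \<open>P + A \<subseteq> K\<close>; the point is to show \<open>K \<subseteq> P + A\<close>.
The work takes place in the interior \<open>U\<close> of the cone of functionals that are bounded above on \<open>K\<close>.
Pointedness of the recession cone ensures that \<open>U\<close> is nonempty, and for \<open>u \<in> U\<close> the support set
\<open>K(u)\<close> is nonempty and bounded, so that the hypothesis on edges can be used at every nonzero
\<open>u \<in> U\<close>.

The heart is \<open>slide_along_segment\<close>. Take \<open>u\<close> and \<open>w\<close> in \<open>U\<close> in general position, a point
\<open>k \<in> K(u)\<close> and the vertex \<open>p\<close> of \<open>P\<close> that maximises \<open>u\<close>. While the functional moves from \<open>u\<close> to
\<open>w\<close>, the maximal vertex of \<open>P\<close> jumps finitely often, each time along an edge of \<open>P\<close>. At such a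
moment \<open>v\<close> the set \<open>K(v)\<close> contains a translate of this edge, so the support points of \<open>K\<close>
advance in the direction \<open>w\<close> at least as far as those of \<open>P\<close>; between two jumps they do
not move backwards. Adding up, \<open>k - p + q\<close> is not beyond \<open>K\<close> in the direction \<open>w\<close>, for each
\<open>q \<in> P\<close>. In other words, the difference of the two support functions is convex along the segment.

General position means that no functional on the segment is zero or orthogonal to two independent
differences of points of \<open>F\<close>. For suitable \<open>u\<close>, this excludes finitely many hyperplanes of
vectors \<open>w\<close>; it is here that the dimension must be at least two, since otherwise the segment could
not be steered around zero. Such restrictions are harmless because a point outside a closed convex
set is separated from it by an open set of functionals in \<open>U\<close> (\<open>open_separating_directions\<close>).
So \<open>k - p + P \<subseteq> K\<close> (\<open>translate_subset_if_edge_translates\<close>), which means \<open>k - p \<in> A\<close>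
and \<open>k \<in> P + A\<close>. Thus \<open>K(u) \<subseteq> P + A\<close> for a dense set of \<open>u \<in> U\<close>, and separating a supposed
point of \<open>K\<close> outside \<open>P + A\<close> by such a \<open>u\<close> is impossible.
\<close>

section \<open>Support sets\<close>

lemma support_set_scaleR:
  assumes "c > 0"
  shows "support_set A (c *\<^sub>R u) = support_set A u"
  using assms by (simp add: support_set_def)

lemma support_set_sum_contains_translate:
  assumes "x \<in> support_set (P + A) u"
  shows "contains_translate_of (support_set (P + A) u) (support_set P u)"
proof -
  have x: "x \<in> P + A" and x_max: "\<And>y. y \<in> P + A \<Longrightarrow> y \<bullet> u \<le> x \<bullet> u"
    using assms by (auto simp: support_set_def)
  obtain p a where pa: "p \<in> P" "a \<in> A" "x = p + a"
    using x by (auto elim: set_plus_elim)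
  have "a + q \<in> support_set (P + A) u" if "q \<in> support_set P u" for q
  proof -
    have q: "q \<in> P" "p \<bullet> u \<le> q \<bullet> u"
      using that pa by (auto simp: support_set_def)
    have "a + q \<in> P + A"
      using q pa by (metis add.commute set_plus_intro)
    moreover have "y \<bullet> u \<le> (a + q) \<bullet> u" if "y \<in> P + A" for y
      using x_max[OF that] q pa by (simp add: inner_add_left)
    ultimately show ?thesis
      by (simp add: support_set_def)
  qed
  then show ?thesis
    unfolding contains_translate_of_def by blast
qed

lemma mem_support_set_convex_hull:
  assumes "p \<in> F" "\<And>q. q \<in> F \<Longrightarrow> q \<bullet> v \<le> p \<bullet> v"
  shows "p \<in> support_set (convex hull F) v"
proof -
  have "convex hull F \<subseteq> {x. v \<bullet> x \<le> p \<bullet> v}"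
  proof (rule hull_minimal)
    show "F \<subseteq> {x. v \<bullet> x \<le> p \<bullet> v}"
      using assms(2) by (auto simp: inner_commute)
  qed (rule convex_halfspace_le)
  then show ?thesis
    using assms(1) by (auto simp: support_set_def hull_inc inner_commute)
qed

text \<open>A support set of a polytope is a face, and the faces of a hull of finitely many points are
spanned by some of these points. This reduces the dimension of a support set to the position of
finitely many points.\<close>

lemma support_set_convex_hull:
  fixes F :: "'a::euclidean_space set"
  assumes "finite F"
  shows "support_set (convex hull F) v = convex hull (F \<inter> support_set (convex hull F) v)"
proof (cases "support_set (convex hull F) v = {}")
  case False
  then obtain m where m: "m \<in> convex hull F" "\<And>x. x \<in> convex hull F \<Longrightarrow> x \<bullet> v \<le> m \<bullet> v"
    by (auto simp: support_set_def)
  then have eq: "support_set (convex hull F) v = convex hull F \<inter> {x. v \<bullet> x = m \<bullet> v}"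
    by (force simp: support_set_def inner_commute)
  have face: "support_set (convex hull F) v face_of convex hull F"
    unfolding eq using m by (intro face_of_Int_supporting_hyperplane_le) (auto simp: inner_commute)
  obtain S where S: "S \<subseteq> F" "support_set (convex hull F) v = convex hull S"
    using face_of_convex_hull_subset[OF finite_imp_compact[OF assms] face] by blast
  have "convex hull S \<subseteq> convex hull (F \<inter> convex hull S)"
    using S(1) by (intro hull_mono) (auto intro: hull_inc)
  moreover have "convex hull (F \<inter> convex hull S) \<subseteq> convex hull S"
    by (intro hull_minimal) auto
  ultimately show ?thesis
    using S(2) by auto
qed auto

section \<open>Sweeping a functional along a segment\<close>

text \<open>The induction is over the number of points of \<open>F\<close> that beat \<open>p\<close> in the direction \<open>w\<close>. Let \<open>v\<close> be
the first functional on the segment for which some such point draws level with \<open>p\<close>, and let \<open>p'\<close> be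
the best in the direction \<open>w\<close> among the points level with \<open>p\<close> at \<open>v\<close>. The hypothesis on the segment
gives \<open>x\<close> such that both \<open>x + p\<close> and \<open>x + p'\<close> are support points of \<open>K\<close> at \<open>v\<close>. The induction
hypothesis handles the remaining segment from \<open>v\<close>, with \<open>p'\<close> and \<open>x + p'\<close> in place of \<open>p\<close> and \<open>k\<close>.

The assumption that \<open>p\<close> wins ties at \<open>u\<close> with respect to \<open>w\<close> makes \<open>v \<noteq> u\<close>, and
the choice of \<open>p'\<close> reproduces it at \<open>v\<close>.\<close>

lemma slide_along_segment:
  fixes K F :: "'a::euclidean_space set"
  assumes "finite F" "p \<in> F"
    and "\<And>r. r \<in> F \<Longrightarrow> r \<bullet> u \<le> p \<bullet> u"
    and "\<And>r. r \<in> F \<Longrightarrow> r \<bullet> u = p \<bullet> u \<Longrightarrow> r \<bullet> w \<le> p \<bullet> w"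
    and "k \<in> support_set K u"
    and "\<And>v a b. v \<in> closed_segment u w \<Longrightarrow> a \<in> F \<Longrightarrow> b \<in> F \<Longrightarrow> a \<noteq> b \<Longrightarrow>
           a \<in> support_set (convex hull F) v \<Longrightarrow> b \<in> support_set (convex hull F) v \<Longrightarrow>
           \<exists>t. t + a \<in> support_set K v \<and> t + b \<in> support_set K v"
    and "q \<in> F"
  shows "\<exists>y\<in>K. (k + (q - p)) \<bullet> w \<le> y \<bullet> w"
  using assms
proof (induction "card {r\<in>F. p \<bullet> w < r \<bullet> w}" arbitrary: u p k rule: less_induct)
  case less
  note p = less.prems(2,3,4) and k = less.prems(5) and edge = less.prems(6)
  define N where "N = {r\<in>F. p \<bullet> w < r \<bullet> w}"
  have fin: "finite N" "finite F"
    using \<open>finite F\<close> by (auto simp: N_def)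
  show ?case
  proof (cases "N = {}")
    case True
    then have "q \<bullet> w \<le> p \<bullet> w"
      using \<open>q \<in> F\<close> by (auto simp: N_def not_less)
    then have "(k + (q - p)) \<bullet> w \<le> k \<bullet> w"
      by (simp add: inner_add_left inner_diff_left)
    then show ?thesis
      using k by (auto simp: support_set_def)
  next
    case False
    define A where "A r = (p - r) \<bullet> u" for r
    define B where "B r = (r - p) \<bullet> w" for r
    have B_pos: "B r > 0" and A_pos: "A r > 0" if "r \<in> N" for r
    proof -
      show "B r > 0"
        using that by (simp add: B_def N_def inner_diff_left)
      have "r \<bullet> u \<noteq> p \<bullet> u" "r \<bullet> u \<le> p \<bullet> u"
        using that p by (force simp: N_def)+
      then show "A r > 0"
        by (simp add: A_def inner_diff_left)
    qed
    (* The value of r overtakes that of p at the parameter A r / (A r + B r). *)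
    define T where "T = (\<lambda>r. A r / (A r + B r)) ` N"
    define t where "t = Min T"
    have T: "finite T" "T \<noteq> {}"
      using fin False by (auto simp: T_def)
    obtain s where s: "s \<in> N" "t = A s / (A s + B s)"
      using Min_in[OF T] by (auto simp: t_def T_def)
    have t: "0 < t" "t < 1"
      using A_pos[OF s(1)] B_pos[OF s(1)] unfolding s(2) by (simp_all add: divide_simps)
    define v where "v = (1 - t) *\<^sub>R u + t *\<^sub>R w"
    have v_inner: "x \<bullet> v = (1 - t) * (x \<bullet> u) + t * (x \<bullet> w)" for x
      by (simp add: v_def inner_add_right)
    have gap: "(p - r) \<bullet> v = A r - t * (A r + B r)" for r
      by (simp add: v_inner A_def B_def inner_diff_left algebra_simps)
    have v_seg: "v \<in> closed_segment u w"
      using t by (auto simp: v_def closed_segment_def)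
    have p_max: "r \<bullet> v \<le> p \<bullet> v" if "r \<in> F" for r
    proof (cases "r \<in> N")
      case True
      then have "t \<le> A r / (A r + B r)"
        using T by (auto simp: t_def T_def)
      then have "t * (A r + B r) \<le> A r"
        using A_pos[OF True] B_pos[OF True] by (simp add: pos_le_divide_eq)
      then show ?thesis
        using gap[of r] by (simp add: inner_diff_left)
    next
      case False
      then have "r \<bullet> w \<le> p \<bullet> w" "r \<bullet> u \<le> p \<bullet> u"
        using that p by (auto simp: N_def)
      then show ?thesis
        unfolding v_inner using t by (intro add_mono mult_left_mono) auto
    qed
    have "(p - s) \<bullet> v = 0"
      unfolding gap using s A_pos[of s] B_pos[of s] by simp
    then have s_top: "s \<in> F" "s \<bullet> v = p \<bullet> v"
      using s by (auto simp: N_def inner_diff_left)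
    define M where "M = {r\<in>F. r \<bullet> v = p \<bullet> v}"
    have M: "finite ((\<lambda>r. r \<bullet> w) ` M)" "(\<lambda>r. r \<bullet> w) ` M \<noteq> {}"
      using fin s_top by (auto simp: M_def)
    obtain p' where p': "p' \<in> M" "p' \<bullet> w = Max ((\<lambda>r. r \<bullet> w) ` M)"
      using Max_in[OF M] by auto
    have p'_top: "r \<bullet> w \<le> p' \<bullet> w" if "r \<in> M" for r
      using M that by (simp add: p'(2))
    have "p \<bullet> w < s \<bullet> w"
      using s by (simp add: N_def)
    also have "s \<bullet> w \<le> p' \<bullet> w"
      using s_top by (intro p'_top) (simp add: M_def)
    finally have pp': "p \<bullet> w < p' \<bullet> w" .
    have p'_F: "p' \<in> F" "p' \<bullet> v = p \<bullet> v"
      using p' by (auto simp: M_def)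
    obtain x where x: "x + p \<in> support_set K v" "x + p' \<in> support_set K v"
      using edge[OF v_seg p(1) p'_F(1)] pp' p_max p'_F p(1)
        mem_support_set_convex_hull[of p F v] mem_support_set_convex_hull[of p' F v]
      by force
    have "\<exists>y\<in>K. (x + p' + (q - p')) \<bullet> w \<le> y \<bullet> w"
    proof (rule less.hyps)
      show "card {r\<in>F. p' \<bullet> w < r \<bullet> w} < card {r\<in>F. p \<bullet> w < r \<bullet> w}"
        using pp' p'_F(1) fin by (intro psubset_card_mono) auto
      show "r \<bullet> v \<le> p' \<bullet> v" if "r \<in> F" for r
        using p_max[OF that] p'_F by simp
      show "r \<bullet> w \<le> p' \<bullet> w" if "r \<in> F" "r \<bullet> v = p' \<bullet> v" for r
        using that p'_F by (intro p'_top) (simp add: M_def)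
      show "\<exists>t. t + a \<in> support_set K v' \<and> t + b \<in> support_set K v'"
        if "v' \<in> closed_segment v w" "a \<in> F" "b \<in> F" "a \<noteq> b"
          "a \<in> support_set (convex hull F) v'" "b \<in> support_set (convex hull F) v'" for v' a b
      proof (rule edge)
        have "closed_segment v w \<subseteq> closed_segment u w"
          using v_seg by (simp add: subset_closed_segment)
        then show "v' \<in> closed_segment u w"
          using that by auto
      qed (use that in auto)
    qed (use x fin p'_F \<open>q \<in> F\<close> in auto)
    then obtain y where y: "y \<in> K" "(x + q) \<bullet> w \<le> y \<bullet> w"
      by (auto simp: algebra_simps)
    (* Monotonicity of support points: k maximises at u and x + p at v, a later point of the
       segment, so the difference k - (x + p) cannot increase in the direction w. *)
    have "(k - (x + p)) \<bullet> v \<le> 0" "(k - (x + p)) \<bullet> u \<ge> 0"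
      using k x by (auto simp: support_set_def inner_diff_left)
    then have "t * ((k - (x + p)) \<bullet> w) \<le> 0"
      unfolding v_inner using t by (smt (verit) mult_nonneg_nonneg)
    then have "(k - (x + p)) \<bullet> w \<le> 0"
      using t by (simp add: mult_le_0_iff)
    then have "(k + (q - p)) \<bullet> w \<le> (x + q) \<bullet> w"
      by (simp add: inner_diff_left inner_add_left)
    then have "(k + (q - p)) \<bullet> w \<le> y \<bullet> w"
      using y(2) by linarith
    then show ?thesis
      using y(1) by blast
  qed
qed

section \<open>Directions in general position\<close>

text \<open>Finitely many hyperplanes form a null set, which cannot cover a nonempty open set.\<close>

lemma exists_nonorthogonal_in_open:
  fixes W D :: "'a::euclidean_space set"
  assumes "open W" "W \<noteq> {}" "finite D"
  obtains w where "w \<in> W" "\<And>a. a \<in> D \<Longrightarrow> a \<noteq> 0 \<Longrightarrow> a \<bullet> w \<noteq> 0"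
proof -
  have "negligible (\<Union>a\<in>D - {0}. {x. a \<bullet> x = 0})"
    using assms(3) by (intro negligible_Union) (auto intro: negligible_hyperplane)
  then have "\<not> W \<subseteq> (\<Union>a\<in>D - {0}. {x. a \<bullet> x = 0})"
    using open_not_negligible[OF assms(1,2)] negligible_subset by blast
  then show ?thesis
    using that by blast
qed

text \<open>
The differences detect ties between points of \<open>F\<close>. The basis is added because every vector is
orthogonal to zero: a segment on which no point is orthogonal to two independent test vectors
then also avoids zero, in dimension at least two.
\<close>

definition test_vectors :: "'a::euclidean_space set \<Rightarrow> 'a set" where
  "test_vectors F = Basis \<union> {q - p | q p. q \<in> F \<and> p \<in> F}"

lemma finite_test_vectors:
  assumes "finite F"
  shows "finite (test_vectors F)"
proof -
  have "{q - p | q p. q \<in> F \<and> p \<in> F} = (\<lambda>(q, p). q - p) ` (F \<times> F)"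
    by auto
  then show ?thesis
    using assms by (simp add: test_vectors_def)
qed

text \<open>If \<open>a\<close> and \<open>b\<close> are both orthogonal to a convex combination of \<open>u\<close> and \<open>w\<close>, then the \<open>2 \<times> 2\<close>
determinant of their products with \<open>u\<close> and \<open>w\<close> vanishes. For fixed \<open>u\<close> this determinant is
linear in \<open>w\<close>, given by the vector \<open>(a \<bullet> u) b - (b \<bullet> u) a\<close>. Hence for independent \<open>a\<close> and \<open>b\<close>
it is enough that \<open>w\<close> avoids a single hyperplane.\<close>

lemma collinear_if_orthogonal_on_segment:
  fixes a b u w :: "'a::real_inner"
  assumes "v \<in> closed_segment u w" "a \<bullet> v = 0" "b \<bullet> v = 0"
    and "(a \<bullet> u) *\<^sub>R b - (b \<bullet> u) *\<^sub>R a = 0 \<or> ((a \<bullet> u) *\<^sub>R b - (b \<bullet> u) *\<^sub>R a) \<bullet> w \<noteq> 0"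
    and "a \<bullet> u \<noteq> 0"
  shows "(a \<bullet> u) *\<^sub>R b = (b \<bullet> u) *\<^sub>R a"
proof -
  obtain t where v: "v = (1 - t) *\<^sub>R u + t *\<^sub>R w"
    using assms(1) by (auto simp: closed_segment_def)
  have eqs: "(1 - t) * (a \<bullet> u) + t * (a \<bullet> w) = 0" "(1 - t) * (b \<bullet> u) + t * (b \<bullet> w) = 0"
    using assms(2,3) by (simp_all add: v inner_add_right)
  have "t \<noteq> 0"
    using eqs(1) assms(5) by auto
  have "t * ((a \<bullet> u) * (b \<bullet> w) - (b \<bullet> u) * (a \<bullet> w)) = 0"
    using eqs by algebra
  then have "((a \<bullet> u) *\<^sub>R b - (b \<bullet> u) *\<^sub>R a) \<bullet> w = 0"
    using \<open>t \<noteq> 0\<close> by (simp add: inner_diff_left)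
  then show ?thesis
    using assms(4) by auto
qed

section \<open>The barrier cone\<close>

definition barrier_cone :: "'a::euclidean_space set \<Rightarrow> 'a set" where
  "barrier_cone K = {u. \<exists>m. \<forall>x\<in>K. x \<bullet> u \<le> m}"

lemma barrier_coneI: "(\<And>x. x \<in> K \<Longrightarrow> x \<bullet> u \<le> m) \<Longrightarrow> u \<in> barrier_cone K"
  by (auto simp: barrier_cone_def)

lemma barrier_coneE:
  assumes "u \<in> barrier_cone K"
  obtains m where "\<And>x. x \<in> K \<Longrightarrow> x \<bullet> u \<le> m"
  using assms by (auto simp: barrier_cone_def)

lemma zero_in_barrier_cone: "0 \<in> barrier_cone K"
  by (auto simp: barrier_cone_def)

lemma barrier_cone_scaleR:
  assumes "u \<in> barrier_cone K" "c \<ge> 0"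
  shows "c *\<^sub>R u \<in> barrier_cone K"
proof -
  obtain m where "\<And>x. x \<in> K \<Longrightarrow> x \<bullet> u \<le> m"
    using barrier_coneE[OF assms(1)] by blast
  then show ?thesis
    using assms(2) by (intro barrier_coneI[where m = "c * m"]) (auto intro: mult_left_mono)
qed

lemma barrier_cone_add:
  assumes "u \<in> barrier_cone K" "v \<in> barrier_cone K"
  shows "u + v \<in> barrier_cone K"
proof -
  obtain m m' where "\<And>x. x \<in> K \<Longrightarrow> x \<bullet> u \<le> m" "\<And>x. x \<in> K \<Longrightarrow> x \<bullet> v \<le> m'"
    using assms by (meson barrier_coneE)
  then show ?thesis
    by (intro barrier_coneI[where m = "m + m'"]) (auto simp: inner_add_right intro: add_mono)
qed

lemma convex_barrier_cone: "convex (barrier_cone K)"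
  by (auto simp: convex_def intro: barrier_cone_add barrier_cone_scaleR)

text \<open>If \<open>z + x\<close> were outside \<open>K\<close> for some \<open>x \<in> K\<close>, a separating functional would be bounded above
on \<open>K\<close>, hence nonpositive at \<open>z\<close>, and then it could not separate \<open>z + x\<close> from \<open>x\<close>.\<close>

lemma recession_cone_if_polar_barrier_cone:
  fixes K :: "'a::euclidean_space set"
  assumes "closed K" "convex K" "\<And>u. u \<in> barrier_cone K \<Longrightarrow> z \<bullet> u \<le> 0"
  shows "z \<in> recession_cone K"
proof -
  have "z + x \<in> K" if "x \<in> K" for x
  proof (rule ccontr)
    assume "z + x \<notin> K"
    then obtain a b where ab: "a \<bullet> (z + x) < b" "\<And>y. y \<in> K \<Longrightarrow> b < a \<bullet> y"
      using separating_hyperplane_closed_point[OF assms(2,1)] by blast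
    have "- a \<in> barrier_cone K"
      using ab(2) by (intro barrier_coneI[where m = "- b"]) (force simp: inner_commute)
    then have "a \<bullet> z \<ge> 0"
      using assms(3) by (force simp: inner_commute)
    moreover have "b < a \<bullet> x"
      using ab(2) that by blast
    ultimately show False
      using ab(1) by (simp add: inner_add_right)
  qed
  then show ?thesis
    by (auto simp: recession_cone_def)
qed

text \<open>A convex cone with empty interior lies in a hyperplane through the origin. A normal vector of
this hyperplane and its negative are both polar to the barrier cone, so both are recession
directions.\<close>

lemma interior_barrier_cone_nonempty:
  fixes K :: "'a::euclidean_space set"
  assumes "closed K" "convex K" "pointed (recession_cone K)"
  shows "interior (barrier_cone K) \<noteq> {}"
proof
  assume "interior (barrier_cone K) = {}"
  then obtain a b where ab: "a \<noteq> 0" "barrier_cone K \<subseteq> {x. a \<bullet> x = b}"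
    using empty_interior_subset_hyperplane[OF convex_barrier_cone] by blast
  then have "b = 0"
    using zero_in_barrier_cone[of K] by auto
  then have "a \<in> recession_cone K" "- a \<in> recession_cone K"
    using assms ab by (auto intro!: recession_cone_if_polar_barrier_cone)
  then have "a \<in> recession_cone K \<inter> uminus ` recession_cone K"
    by (force intro: image_eqI[where x = "- a"])
  then have "a \<in> {0}"
    using assms(3) unfolding pointed_def by blast
  then show False
    using ab(1) by simp
qed

text \<open>For small \<open>e > 0\<close> the functionals \<open>u \<plusminus> e i\<close> with \<open>i\<close> a basis vector are still bounded above
on \<open>K\<close>; where \<open>u\<close> is bounded below, this bounds every coordinate.\<close>

lemma bounded_superlevel_interior_barrier_cone:
  fixes K :: "'a::euclidean_space set"
  assumes "u \<in> interior (barrier_cone K)"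
  shows "bounded {x\<in>K. c \<le> x \<bullet> u}"
proof -
  obtain e where e: "e > 0" "cball u e \<subseteq> barrier_cone K"
    using assms by (auto simp: mem_interior_cball)
  have "\<exists>m. \<forall>x\<in>{x\<in>K. c \<le> x \<bullet> u}. \<bar>x \<bullet> i\<bar> \<le> m" if "i \<in> Basis" for i
  proof -
    have "u + e *\<^sub>R i \<in> barrier_cone K" "u - e *\<^sub>R i \<in> barrier_cone K"
      using e that by (auto intro!: subsetD[OF e(2)] simp: dist_norm)
    then obtain m m' where
      "\<And>x. x \<in> K \<Longrightarrow> x \<bullet> (u + e *\<^sub>R i) \<le> m" "\<And>x. x \<in> K \<Longrightarrow> x \<bullet> (u - e *\<^sub>R i) \<le> m'"
      by (meson barrier_coneE)
    then have "e * \<bar>x \<bullet> i\<bar> \<le> max m m' - c" if "x \<in> K" "c \<le> x \<bullet> u" for x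
      using that by (fastforce simp: inner_add_right inner_diff_right abs_if)
    then have "\<bar>x \<bullet> i\<bar> \<le> (max m m' - c) / e" if "x \<in> K" "c \<le> x \<bullet> u" for x
      using that e by (simp add: pos_le_divide_eq mult.commute)
    then show ?thesis
      by blast
  qed
  then obtain m where m: "\<And>i x. i \<in> Basis \<Longrightarrow> x \<in> K \<Longrightarrow> c \<le> x \<bullet> u \<Longrightarrow> \<bar>x \<bullet> i\<bar> \<le> m i"
    by simp metis
  have "norm x \<le> (\<Sum>i\<in>Basis. m i)" if "x \<in> K" "c \<le> x \<bullet> u" for x
    using norm_le_l1[of x] sum_mono[of Basis "\<lambda>i. \<bar>x \<bullet> i\<bar>" m] m that by force
  then show ?thesis
    by (auto simp: bounded_iff)
qed

lemma support_set_interior_barrier_cone: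
  fixes K :: "'a::euclidean_space set"
  assumes "closed K" "K \<noteq> {}" "u \<in> interior (barrier_cone K)"
  shows "support_set K u \<noteq> {}" "bounded (support_set K u)"
proof -
  obtain y where y: "y \<in> K"
    using assms(2) by blast
  define S where "S = {x\<in>K. y \<bullet> u \<le> x \<bullet> u}"
  have bd: "bounded S"
    unfolding S_def using assms(3) by (rule bounded_superlevel_interior_barrier_cone)
  have "S = K \<inter> {x. y \<bullet> u \<le> u \<bullet> x}"
    by (auto simp: S_def inner_commute)
  then have "compact S"
    using bd assms(1) closed_halfspace_ge[of "y \<bullet> u" u]
    by (auto simp: compact_eq_bounded_closed intro!: closed_Int)
  moreover have "S \<noteq> {}"
    using y by (auto simp: S_def)
  moreover have "continuous_on S (\<lambda>x. x \<bullet> u)"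
    by (intro continuous_intros)
  ultimately obtain x where x: "x \<in> S" "\<And>z. z \<in> S \<Longrightarrow> z \<bullet> u \<le> x \<bullet> u"
    using continuous_attains_sup[of S "\<lambda>x. x \<bullet> u"] by blast
  then have "x \<in> support_set K u"
    by (force simp: support_set_def S_def)
  then show "support_set K u \<noteq> {}"
    by blast
  have "support_set K u \<subseteq> S"
    using y by (auto simp: support_set_def S_def)
  then show "bounded (support_set K u)"
    using bd bounded_subset by blast
qed

text \<open>One half of the bipolar theorem: the barrier cone is dense in the polar of the recession cone.\<close>

lemma closure_barrier_cone_if_recession_nonpos:
  fixes K :: "'a::euclidean_space set"
  assumes "closed K" "convex K"
    and v: "\<And>z. z \<in> recession_cone K \<Longrightarrow> z \<bullet> v \<le> 0"
  shows "v \<in> closure (barrier_cone K)"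
proof (rule ccontr)
  assume "v \<notin> closure (barrier_cone K)"
  then obtain a b where ab: "a \<bullet> v < b" "\<And>y. y \<in> closure (barrier_cone K) \<Longrightarrow> b < a \<bullet> y"
    using separating_hyperplane_closed_point[OF convex_closure[OF convex_barrier_cone]] closed_closure
    by blast
  have b: "b < a \<bullet> y" if "y \<in> barrier_cone K" for y
    using ab(2) closure_subset that by blast
  have "b < 0"
    using b[OF zero_in_barrier_cone] by simp
  have "- a \<in> recession_cone K"
  proof (rule recession_cone_if_polar_barrier_cone[OF assms(1,2)])
    fix u assume u: "u \<in> barrier_cone K"
    show "- a \<bullet> u \<le> 0"
    proof (rule ccontr)
      assume "\<not> - a \<bullet> u \<le> 0"
      then have neg: "a \<bullet> u < 0"
        by simp
      have "b < a \<bullet> ((b / (a \<bullet> u)) *\<^sub>R u)"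
        using neg \<open>b < 0\<close> u
        by (intro b barrier_cone_scaleR) (auto intro: divide_nonpos_nonpos)
      then show False
        using neg by simp
    qed
  qed
  then show False
    using v[of "- a"] ab(1) \<open>b < 0\<close> by simp
qed

text \<open>An ordinary separating functional \<open>v\<close> for \<open>x\<close> and \<open>C\<close> is bounded above on \<open>C\<close>, hence nonpositive on
the recession directions that \<open>C\<close> shares with \<open>K\<close>, and so it lies in the closure of the barrier
cone of \<open>K\<close>. A slight push moves it into the interior. There the support function of \<open>C\<close> is finite
and convex, hence continuous, so that strict separation is an open condition.

The lemma is applied with \<open>C = K\<close> and with \<open>C = P + A\<close>. In the second case the functionals must
come from the barrier cone of \<open>K\<close>, as the edge hypothesis only concerns those.\<close>

lemma open_separating_directions:
  fixes K C :: "'a::euclidean_space set"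
  assumes K: "closed K" "convex K" "interior (barrier_cone K) \<noteq> {}"
    and C: "closed C" "convex C" "C \<noteq> {}" "C \<subseteq> K"
    and rec: "\<And>z c. z \<in> recession_cone K \<Longrightarrow> c \<in> C \<Longrightarrow> z + c \<in> C"
    and "x \<notin> C"
  obtains W where "open W" "W \<noteq> {}" "W \<subseteq> interior (barrier_cone K)"
    "\<forall>w\<in>W. \<forall>y\<in>C. y \<bullet> w < x \<bullet> w"
proof -
  let ?U = "interior (barrier_cone K)"
  define h where "h w = Sup ((\<lambda>y. y \<bullet> w) ` C)" for w
  have bdd: "bdd_above ((\<lambda>y. y \<bullet> w) ` C)" if "w \<in> ?U" for w
    using that C(4) interior_subset[of "barrier_cone K"] by (force simp: barrier_cone_def bdd_above_def)
  have h_upper: "y \<bullet> w \<le> h w" if "w \<in> ?U" "y \<in> C" for w y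
    unfolding h_def using bdd that by (auto intro: cSup_upper)
  have h_least: "h w \<le> m" if "\<And>y. y \<in> C \<Longrightarrow> y \<bullet> w \<le> m" for w m
    unfolding h_def using C(3) that by (auto intro: cSup_least)
  have "convex_on ?U h"
  proof
    show "convex ?U"
      by (simp add: convex_interior convex_barrier_cone)
    fix t :: real and v w assume *: "0 < t" "t < 1" "v \<in> ?U" "w \<in> ?U"
    show "h ((1 - t) *\<^sub>R v + t *\<^sub>R w) \<le> (1 - t) * h v + t * h w"
      using * h_upper
      by (intro h_least) (auto simp: inner_add_right intro!: add_mono mult_left_mono)
  qed
  then have cont: "continuous_on ?U h"
    by (intro convex_on_continuous) auto
  define W where "W = ?U \<inter> (\<lambda>w. h w - x \<bullet> w) -` {..<0}"
  have "open W"
    unfolding W_def using cont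
    by (intro continuous_open_preimage continuous_intros) auto
  moreover have "W \<noteq> {}"
  proof -
    obtain a b where ab: "a \<bullet> x < b" "\<And>y. y \<in> C \<Longrightarrow> b < a \<bullet> y"
      using separating_hyperplane_closed_point[OF C(2,1) \<open>x \<notin> C\<close>] by blast
    define v where "v = - a"
    have v: "- b < x \<bullet> v" "\<And>y. y \<in> C \<Longrightarrow> y \<bullet> v \<le> - b"
      using ab by (force simp: v_def inner_commute)+
    have v_cl: "v \<in> closure (barrier_cone K)"
    proof (rule closure_barrier_cone_if_recession_nonpos[OF K(1,2)], rule ccontr)
      fix z assume z: "z \<in> recession_cone K" and "\<not> z \<bullet> v \<le> 0"
      then have pos: "z \<bullet> v > 0"
        by simp
      obtain c where c: "c \<in> C"
        using C(3) by blast
      have mult: "of_nat n *\<^sub>R z + c \<in> C" for n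
      proof (induction n)
        case (Suc n)
        then show ?case
          using rec[OF z, of "of_nat n *\<^sub>R z + c"] by (simp add: scaleR_left_distrib add.assoc)
      qed (simp add: c)
      obtain n where "- b - c \<bullet> v < of_nat n * (z \<bullet> v)"
        using reals_Archimedean3[OF pos] by blast
      then show False
        using v(2)[OF mult[of n]] by (simp add: inner_add_left)
    qed
    obtain u where u: "u \<in> ?U"
      using K(3) by blast
    (* v may lie on the boundary of the barrier cone, where the support function of C need not
       be continuous, so v is moved a little towards the interior point u; e is small enough
       for the strict separation to survive. *)
    define d where "d = x \<bullet> v + b"
    define M where "M = \<bar>h u - x \<bullet> u\<bar>"
    define e where "e = d / (d + M + 1)"
    have d: "d > 0" "M \<ge> 0"
      using v(1) by (auto simp: d_def M_def)
    have e: "0 < e" "e \<le> 1" "e * (d + M) < d"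
      using d by (auto simp: e_def divide_simps mult_less_cancel_left_pos)
    define w where "w = v - e *\<^sub>R (v - u)"
    have w_U: "w \<in> ?U"
      unfolding w_def using u v_cl e
      by (intro mem_interior_closure_convex_shrink convex_barrier_cone) auto
    have w_inner: "y \<bullet> w = (1 - e) * (y \<bullet> v) + e * (y \<bullet> u)" for y
      by (simp add: w_def inner_diff_right algebra_simps)
    have "h w \<le> (1 - e) * (- b) + e * h u"
    proof (rule h_least)
      fix y assume "y \<in> C"
      then have "(1 - e) * (y \<bullet> v) \<le> (1 - e) * (- b)" "e * (y \<bullet> u) \<le> e * h u"
        using e v(2) h_upper[OF u] by (intro mult_left_mono; simp)+
      then show "y \<bullet> w \<le> (1 - e) * (- b) + e * h u"
        unfolding w_inner by (rule add_mono)
    qed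
    moreover have "e * (h u - x \<bullet> u) \<le> e * M"
      using e by (intro mult_left_mono) (auto simp: M_def)
    then have "(1 - e) * (- b) + e * h u < x \<bullet> w"
      using e(3) by (simp add: w_inner d_def algebra_simps)
    ultimately have "w \<in> W"
      using w_U by (simp add: W_def)
    then show ?thesis
      by blast
  qed
  moreover have "y \<bullet> w < x \<bullet> w" if "w \<in> W" "y \<in> C" for w y
    using h_upper[of w y] that by (auto simp: W_def)
  ultimately show ?thesis
    using that W_def by blast
qed

section \<open>Edge translates force a summand\<close>

lemma aff_dim_support_set_convex_hull:
  fixes F :: "'a::euclidean_space set"
  assumes "finite F" "p \<in> F" "q \<in> F" "p \<noteq> q"
    and "p \<in> support_set (convex hull F) v" "q \<in> support_set (convex hull F) v"
    and line: "\<And>r. r \<in> F \<Longrightarrow> r \<in> support_set (convex hull F) v \<Longrightarrow> \<exists>c. r - p = c *\<^sub>R (q - p)"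
  shows "aff_dim (support_set (convex hull F) v) = 1"
proof -
  have aff: "aff_dim {p, q} = 1"
    using \<open>p \<noteq> q\<close> by (simp add: aff_dim_2)
  have "F \<inter> support_set (convex hull F) v \<subseteq> affine hull {p, q}"
  proof
    fix r assume "r \<in> F \<inter> support_set (convex hull F) v"
    then obtain c where "r - p = c *\<^sub>R (q - p)"
      using line by blast
    then have "r = (1 - c) *\<^sub>R p + c *\<^sub>R q \<and> (1 - c) + c = 1"
      by (simp add: algebra_simps)
    then show "r \<in> affine hull {p, q}"
      unfolding affine_hull_2 by blast
  qed
  then have "convex hull (F \<inter> support_set (convex hull F) v) \<subseteq> affine hull {p, q}"
    by (intro hull_minimal) (auto intro: affine_imp_convex)
  then have "support_set (convex hull F) v \<subseteq> affine hull {p, q}"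
    using support_set_convex_hull[OF assms(1), of v] by simp
  then have "aff_dim (support_set (convex hull F) v) \<le> aff_dim (affine hull {p, q})"
    by (rule aff_dim_subset)
  moreover have "aff_dim {p, q} \<le> aff_dim (support_set (convex hull F) v)"
    using assms by (intro aff_dim_subset) auto
  ultimately show ?thesis
    using aff by simp
qed

text \<open>The genericity of \<open>u\<close> makes \<open>p\<close> the only point of \<open>F\<close> that maximises \<open>u\<close>, so that the same
\<open>p\<close> serves all targets \<open>w\<close> of the sweep. If \<open>k - p + q\<close> were outside \<open>K\<close>, it would be separated
from \<open>K\<close> by a functional \<open>w\<close> in general position relative to \<open>u\<close>, and sweeping from \<open>u\<close> to \<open>w\<close>
contradicts this.\<close>

lemma translate_subset_if_edge_translates:
  fixes K F :: "'a::euclidean_space set"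
  assumes "DIM('a) \<ge> 2"
    and K: "closed K" "convex K" "interior (barrier_cone K) \<noteq> {}"
    and F: "finite F"
    and edges: "\<And>u. u \<in> sphere 0 1 \<Longrightarrow> bounded_edge_of (support_set (convex hull F) u) (convex hull F) \<Longrightarrow>
           support_set K u \<noteq> {} \<Longrightarrow> bounded (support_set K u) \<Longrightarrow>
           contains_translate_of (support_set K u) (support_set (convex hull F) u)"
    and u: "u \<in> interior (barrier_cone K)"
      "\<And>a. a \<in> test_vectors F \<Longrightarrow> a \<noteq> 0 \<Longrightarrow> a \<bullet> u \<noteq> 0"
    and k: "k \<in> support_set K u"
    and p: "p \<in> F" "p \<in> support_set (convex hull F) u"
  shows "(+) (k - p) ` (convex hull F) \<subseteq> K"
proof -
  have K_ne: "K \<noteq> {}"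
    using k by (auto simp: support_set_def)
  have p_max: "r \<bullet> u \<le> p \<bullet> u" if "r \<in> F" for r
    using p(2) that by (auto simp: support_set_def hull_inc)
  have rec: "z + c \<in> K" if "z \<in> recession_cone K" "c \<in> K" for z c
    using that by (auto simp: recession_cone_def)
  have "k - p + q \<in> K" if q: "q \<in> F" for q
  proof (rule ccontr)
    assume notin: "k - p + q \<notin> K"
    obtain W where W: "open W" "W \<noteq> {}" "W \<subseteq> interior (barrier_cone K)"
      "\<forall>w\<in>W. \<forall>y\<in>K. y \<bullet> w < (k - p + q) \<bullet> w"
      by (rule open_separating_directions[OF K K(1,2) K_ne subset_refl rec notin])
    (* The vectors whose orthogonal hyperplanes w has to avoid. *)
    define E where "E = (\<lambda>(a, b). (a \<bullet> u) *\<^sub>R b - (b \<bullet> u) *\<^sub>R a) ` (test_vectors F \<times> test_vectors F)"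
    have "finite E"
      using finite_test_vectors[OF F] by (simp add: E_def)
    then obtain w where w: "w \<in> W" "\<And>c. c \<in> E \<Longrightarrow> c \<noteq> 0 \<Longrightarrow> c \<bullet> w \<noteq> 0"
      using exists_nonorthogonal_in_open[OF W(1,2)] by blast
    have seg: "v \<in> interior (barrier_cone K)" if "v \<in> closed_segment u w" for v
      using that u(1) w(1) W(3) closed_segment_subset[of u "interior (barrier_cone K)" w]
      by (auto simp: convex_interior convex_barrier_cone)
    have parallel: "(a \<bullet> u) *\<^sub>R b = (b \<bullet> u) *\<^sub>R a"
      if "v \<in> closed_segment u w" "a \<in> test_vectors F" "b \<in> test_vectors F" "a \<bullet> v = 0" "b \<bullet> v = 0" "a \<noteq> 0" for v a b
    proof (rule collinear_if_orthogonal_on_segment[OF that(1,4,5)])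
      show "(a \<bullet> u) *\<^sub>R b - (b \<bullet> u) *\<^sub>R a = 0 \<or> ((a \<bullet> u) *\<^sub>R b - (b \<bullet> u) *\<^sub>R a) \<bullet> w \<noteq> 0"
      proof -
        have "(a \<bullet> u) *\<^sub>R b - (b \<bullet> u) *\<^sub>R a \<in> E"
          using that(2,3) unfolding E_def by (intro image_eqI[where x = "(a, b)"]) auto
        then show ?thesis
          using w(2) by blast
      qed
    qed (use u(2) that in auto)
    (* Two distinct basis vectors are independent, so they cannot both be orthogonal to v. *)
    have v_nz: "v \<noteq> 0" if v: "v \<in> closed_segment u w" for v
    proof
      assume "v = 0"
      obtain i j :: 'a where ij: "i \<in> Basis" "j \<in> Basis" "i \<noteq> j"
        using assms(1) by (metis (no_types, lifting) card_2_iff' ex_card subset_iff)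
      have "(i \<bullet> u) *\<^sub>R j = (j \<bullet> u) *\<^sub>R i"
        using parallel[OF v, of i j] ij nonzero_Basis[OF ij(1)] \<open>v = 0\<close> by (simp add: test_vectors_def)
      then have "((i \<bullet> u) *\<^sub>R j) \<bullet> j = ((j \<bullet> u) *\<^sub>R i) \<bullet> j"
        by simp
      then have "i \<bullet> u = 0"
        using ij by (simp add: inner_Basis)
      then show False
        using u(2)[of i] ij nonzero_Basis[OF ij(1)] by (simp add: test_vectors_def)
    qed
    have "\<exists>y\<in>K. (k + (q - p)) \<bullet> w \<le> y \<bullet> w"
    proof (rule slide_along_segment[OF F p(1) p_max _ k _ q])
      fix r assume r: "r \<in> F" "r \<bullet> u = p \<bullet> u"
      have "r - p = 0"
        using u(2)[of "r - p"] r p(1) by (auto simp: test_vectors_def inner_diff_left)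
      then show "r \<bullet> w \<le> p \<bullet> w"
        by simp
    next
      fix v a b
      assume v: "v \<in> closed_segment u w" and ab: "a \<in> F" "b \<in> F" "a \<noteq> b"
        "a \<in> support_set (convex hull F) v" "b \<in> support_set (convex hull F) v"
      have orth: "(r - a) \<bullet> v = 0" if "r \<in> support_set (convex hull F) v" for r
        using that ab(4) by (auto simp: support_set_def inner_diff_left intro: antisym)
      have "aff_dim (support_set (convex hull F) v) = 1"
      proof (rule aff_dim_support_set_convex_hull[OF F ab])
        fix r assume r: "r \<in> F" "r \<in> support_set (convex hull F) v"
        have D: "b - a \<in> test_vectors F" "r - a \<in> test_vectors F"
          using r ab by (auto simp: test_vectors_def)
        have "((b - a) \<bullet> u) *\<^sub>R (r - a) = ((r - a) \<bullet> u) *\<^sub>R (b - a)"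
          using parallel[OF v D] orth r ab by auto
        moreover have "(b - a) \<bullet> u \<noteq> 0"
          using u(2)[OF D(1)] ab by auto
        ultimately have "r - a = (((r - a) \<bullet> u) / ((b - a) \<bullet> u)) *\<^sub>R (b - a)"
          by (metis (no_types, lifting) divide_inverse_commute scaleR_one scaleR_scaleR left_inverse)
        then show "\<exists>c. r - a = c *\<^sub>R (b - a)"
          by blast
      qed
      moreover have "bounded (support_set (convex hull F) v)"
        using finite_imp_bounded_convex_hull[OF F]
        by (rule bounded_subset) (auto simp: support_set_def)
      ultimately have edge: "bounded_edge_of (support_set (convex hull F) v) (convex hull F)"
        by (auto simp: bounded_edge_of_def)
      (* The edge hypothesis speaks of unit vectors only. *)
      define v' where "v' = (1 / norm v) *\<^sub>R v"
      have v': "v' \<in> sphere 0 1" "support_set A v' = support_set A v" for A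
        using v_nz[OF v] by (auto simp: v'_def support_set_scaleR)
      have "contains_translate_of (support_set K v) (support_set (convex hull F) v)"
        using edges[of v'] v' edge support_set_interior_barrier_cone[OF K(1) K_ne seg[OF v]] by simp
      then show "\<exists>t. t + a \<in> support_set K v \<and> t + b \<in> support_set K v"
        using ab by (auto simp: contains_translate_of_def)
    qed
    then show False
      using W(4) w(1) by (force simp: algebra_simps)
  qed
  then have "F \<subseteq> (+) (p - k) ` K"
    by (force intro: image_eqI[where x = "k - p + q" for q])
  then have "convex hull F \<subseteq> (+) (p - k) ` K"
    using K(2) by (intro hull_minimal convex_translation) auto
  then show ?thesis
    by auto
qed

theorem theorem5p2:
  fixes K P :: "(real ^ 'n) set"
  assumes "CARD('n) \<ge> 2"
    and "K \<noteq> {}" and "closed K" and "convex K"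
    and "pointed (recession_cone K)"
    and "P \<noteq> {}" and "polytope P"
  shows "summand_of P K \<longleftrightarrow>
    (\<forall>u \<in> sphere 0 1.
       bounded_edge_of (support_set P u) P \<and> support_set K u \<noteq> {} \<and> bounded (support_set K u)
       \<longrightarrow> contains_translate_of (support_set K u) (support_set P u))"
    (is "_ \<longleftrightarrow> ?edges")
proof
  assume "summand_of P K"
  then obtain A where "K = P + A"
    by (auto simp: summand_of_def)
  then show ?edges
    using support_set_sum_contains_translate by blast
next
  assume edges: ?edges
  obtain F where F: "finite F" "P = convex hull F"
    using assms(7) by (auto simp: polytope_def)
  have dim: "DIM(real ^ 'n) \<ge> 2"
    using assms(1) by simp
  let ?U = "interior (barrier_cone K)"
  have U: "?U \<noteq> {}"
    using assms by (intro interior_barrier_cone_nonempty)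
  define A where "A = {x. \<forall>p\<in>P. p + x \<in> K}"
  have A_eq: "A = (\<Inter>p\<in>P. (\<lambda>x. x - p) ` K)"
    by (force simp: A_def image_iff algebra_simps)
  have A: "closed A" "convex A"
    unfolding A_eq using assms(3,4)
    by (auto intro!: closed_INT convex_INT closed_translation_subtract convex_translation_subtract)
  have sub: "P + A \<subseteq> K"
    by (auto simp: A_def elim!: set_plus_elim)
  have key: "\<exists>w\<in>W. support_set K w \<noteq> {} \<and> support_set K w \<subseteq> P + A"
    if W: "open W" "W \<noteq> {}" "W \<subseteq> ?U" for W
  proof -
    obtain w where w: "w \<in> W" "\<And>a. a \<in> test_vectors F \<Longrightarrow> a \<noteq> 0 \<Longrightarrow> a \<bullet> w \<noteq> 0"
      using exists_nonorthogonal_in_open[OF W(1,2) finite_test_vectors[OF F(1)]] by blast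
    have F_ne: "finite ((\<lambda>p. p \<bullet> w) ` F)" "(\<lambda>p. p \<bullet> w) ` F \<noteq> {}"
      using F assms(6) by auto
    obtain p where p: "p \<in> F" "p \<bullet> w = Max ((\<lambda>p. p \<bullet> w) ` F)"
      using Max_in[OF F_ne] by auto
    have "p \<in> support_set P w"
      unfolding F using F_ne p by (intro mem_support_set_convex_hull) auto
    moreover have "k \<in> P + A" if k: "k \<in> support_set K w" for k
    proof -
      have "(+) (k - p) ` P \<subseteq> K"
        unfolding F(2)
      proof (rule translate_subset_if_edge_translates[OF dim assms(3,4) U F(1) _ _ _ k p(1)])
        show "w \<in> ?U"
          using w W by blast
      qed (use edges w calculation F in auto)
      then have "k - p \<in> A"
        by (auto simp: A_def add.commute)
      moreover have "p \<in> P"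
        using p F by (simp add: hull_inc)
      ultimately have "p + (k - p) \<in> P + A"
        by (intro set_plus_intro)
      then show ?thesis
        by simp
    qed
    moreover have "support_set K w \<noteq> {}"
      using w W assms by (intro support_set_interior_barrier_cone) auto
    ultimately show ?thesis
      using w(1) by blast
  qed
  have PA_ne: "P + A \<noteq> {}"
    using key[of ?U] U by auto
  have "closed (\<Union>x\<in>P. \<Union>y\<in>A. {x + y})"
    using assms(7) A(1) by (intro compact_closed_sums polytope_imp_compact)
  moreover have "(\<Union>x\<in>P. \<Union>y\<in>A. {x + y}) = P + A"
    by (auto simp: set_plus_def)
  ultimately have PA_closed: "closed (P + A)"
    by simp
  have PA_convex: "convex (P + A)"
    using convex_set_plus[OF polytope_imp_convex[OF assms(7)] A(2)] .
  have PA_rec: "z + c \<in> P + A" if z: "z \<in> recession_cone K" and c: "c \<in> P + A" for z c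
  proof -
    obtain p a where pa: "p \<in> P" "a \<in> A" "c = p + a"
      using c by (auto elim: set_plus_elim)
    have "z + (q + a) \<in> K" if "q \<in> P" for q
      using z pa that by (auto simp: recession_cone_def A_def)
    then have "z + a \<in> A"
      by (auto simp: A_def algebra_simps)
    then have "p + (z + a) \<in> P + A"
      using pa by (intro set_plus_intro)
    then show ?thesis
      using pa by (simp add: algebra_simps)
  qed
  have "K \<subseteq> P + A"
  proof (rule ccontr)
    assume "\<not> K \<subseteq> P + A"
    then obtain x where x: "x \<in> K" "x \<notin> P + A"
      by blast
    obtain W where W: "open W" "W \<noteq> {}" "W \<subseteq> ?U"
      "\<forall>w\<in>W. \<forall>y\<in>P + A. y \<bullet> w < x \<bullet> w"
      by (rule open_separating_directions[OF assms(3,4) U PA_closed PA_convex PA_ne sub PA_rec x(2)])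
    obtain w k where wk: "w \<in> W" "k \<in> support_set K w" "k \<in> P + A"
      using key[OF W(1-3)] by blast
    then have "x \<bullet> w \<le> k \<bullet> w"
      using x(1) by (simp add: support_set_def)
    then show False
      using W(4) wk(1,3) by force
  qed
  then have "K = P + A"
    using sub by blast
  moreover have "A \<noteq> {}"
    using PA_ne by (auto simp: set_plus_def)
  ultimately show "summand_of P K"
    using A unfolding summand_of_def by blast
qed

end
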